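(* Let $(R,<)$ be an ordered commutative ring with $1$ whose order $\leq$ is a total ordering, such that $R$ is dense and shrinkable. Let $r\in R$ with $r\neq 1$. Then the following statements hold: (1) If the sequence $(r^n)$ is convergent, then it converges to zero. (2) The geometric series $\sum_{n=0}^{+\infty}r^n$ is convergent in $R$ if and only if the sequence $(r^n)$ converges to zero and $1-r$ is invertible in $R$.
   Context: $(R,<)$ with $\leq$ total is an ordered ring if $R$ is a ring, $a<b$ implies $a+c<b+c$, and $a<b$, $0<c$ imply $ac<bc$ and $ca<cb$, for all $a,b,c\in R$ (similarly for $\leq$, with $c\geq 0$). $R$ is dense if for any $\alpha>0$ in $R$ there are $\beta>0$ and $\gamma>0$ in $R$ with $\beta+\gamma<\alpha$. $R$ is shrinkable if for any given $\alpha>0$ and $M>0$ in $R$ there are $\alpha_l>0$ and $\alpha_r>0$ in $R$ with $M\alpha_r<\alpha$ and $\alpha_l M<\alpha$. Put $|x|=\max\{x,-x\}$. A sequence $(x_n)$ in $R$ converges to $a\in R$ if for every $\epsilon>0$ in $R$ there is a natural number $N$ such that $n\geq N$ implies $|x_n-a|<\epsilon$. A series converges if its sequence of partial sums converges. *)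

theory Defs
  imports Main
begin

(* The ordered commutative rings with 1 and total order are rendered by the class
   linordered_idom. It assumes in addition only 0 \<noteq> 1: strict monotonicity of
   multiplication already gives 0 < 1 in a nonzero ring and excludes zero divisors.
   The zero ring is irrelevant where an element r \<noteq> 1 is given.
   In this class \<bar>x\<bar> is max x (- x), see abs_eq_max below.

   Denseness and shrinkability are properties of the whole ring, hence of the type. *)

lemma abs_eq_max: "\<bar>x\<bar> = max x (- x)" for x :: "'a::linordered_idom"
  by (auto simp: abs_if max_def)

definition dense_ring :: "'a::linordered_idom itself \<Rightarrow> bool" where
  "dense_ring _ \<longleftrightarrow> (\<forall>\<alpha>::'a. \<alpha> > 0 \<longrightarrow> (\<exists>\<beta> \<gamma>. \<beta> > 0 \<and> \<gamma> > 0 \<and> \<beta> + \<gamma> < \<alpha>))"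

definition shrinkable_ring :: "'a::linordered_idom itself \<Rightarrow> bool" where
  "shrinkable_ring _ \<longleftrightarrow>
     (\<forall>(\<alpha>::'a) M. \<alpha> > 0 \<and> M > 0 \<longrightarrow>
        (\<exists>\<alpha>\<^sub>l \<alpha>\<^sub>r. \<alpha>\<^sub>l > 0 \<and> \<alpha>\<^sub>r > 0 \<and> M * \<alpha>\<^sub>r < \<alpha> \<and> \<alpha>\<^sub>l * M < \<alpha>))"

(* The limits below use \<epsilon> ranging over R itself; R need not be Archimedean, so the
   library's real-valued metric limits do not apply. *)

definition seq_converges_to :: "(nat \<Rightarrow> 'a::linordered_idom) \<Rightarrow> 'a \<Rightarrow> bool" where
  "seq_converges_to x a \<longleftrightarrow> (\<forall>\<epsilon>>0. \<exists>N. \<forall>n\<ge>N. \<bar>x n - a\<bar> < \<epsilon>)"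

definition seq_convergent :: "(nat \<Rightarrow> 'a::linordered_idom) \<Rightarrow> bool" where
  "seq_convergent x \<longleftrightarrow> (\<exists>a. seq_converges_to x a)"

definition series_convergent :: "(nat \<Rightarrow> 'a::linordered_idom) \<Rightarrow> bool" where
  "series_convergent x \<longleftrightarrow> seq_convergent (\<lambda>n. \<Sum>k\<le>n. x k)"

end

theory Submission
  imports Defs
begin

text \<open>
  Denseness makes limits unique and compatible with subtraction, and shrinkability makes them
  compatible with multiplication by a constant (\<open>seq_converges_unique\<close>, \<open>seq_converges_diff\<close>,
  \<open>seq_converges_mult_left\<close>). After that both parts come from comparing two limits of one
  sequence.

  If \<open>r ^ n\<close> tends to \<open>a\<close>, the successive differences \<open>(r - 1) * r ^ n\<close> tend both to \<open>0\<close> and to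
  \<open>(r - 1) * a\<close>. As \<open>r \<noteq> 1\<close> and there are no zero divisors, \<open>a = 0\<close>.

  The partial sums \<open>S n\<close> of the geometric series satisfy \<open>(1 - r) * S n = 1 - r ^ Suc n\<close>. If they
  tend to \<open>s\<close>, their successive differences \<open>r ^ Suc n\<close> tend to \<open>0\<close>, so the two sides tend to
  \<open>(1 - r) * s\<close> and to \<open>1\<close>, which makes \<open>s\<close> an inverse of \<open>1 - r\<close>. Conversely, multiplying the
  identity by an inverse \<open>u\<close> of \<open>1 - r\<close> shows that the partial sums tend to \<open>u\<close> when \<open>r ^ n\<close>
  tends to \<open>0\<close>.
\<close>

text \<open>Replacing both summands by the smaller one provides the substitute for \<open>\<epsilon> / 2\<close> in a ring
  where \<open>2\<close> may have no inverse.\<close>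

lemma dense_ring_half:
  fixes \<epsilon> :: "'a::linordered_idom"
  assumes "dense_ring TYPE('a)" and "\<epsilon> > 0"
  obtains \<delta> where "\<delta> > 0" and "\<delta> + \<delta> < \<epsilon>"
proof -
  obtain \<beta> \<gamma> where "\<beta> > 0" "\<gamma> > 0" "\<beta> + \<gamma> < \<epsilon>"
    using assms unfolding dense_ring_def by blast
  moreover have "min \<beta> \<gamma> + min \<beta> \<gamma> \<le> \<beta> + \<gamma>"
    by (intro add_mono) auto
  ultimately show thesis
    using that[of "min \<beta> \<gamma>"] by auto
qed

lemma seq_converges_const: "seq_converges_to (\<lambda>n. a) a"
  unfolding seq_converges_to_def by simp

lemma seq_converges_diff:
  fixes a b :: "'a::linordered_idom"
  assumes dense: "dense_ring TYPE('a)"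
    and x: "seq_converges_to x a" and y: "seq_converges_to y b"
  shows "seq_converges_to (\<lambda>n. x n - y n) (a - b)"
  unfolding seq_converges_to_def
proof (intro allI impI)
  fix \<epsilon> :: 'a
  assume "\<epsilon> > 0"
  then obtain \<delta> where \<delta>: "\<delta> > 0" "\<delta> + \<delta> < \<epsilon>"
    using dense_ring_half[OF dense] by blast
  obtain N where N: "\<bar>x n - a\<bar> < \<delta>" if "n \<ge> N" for n
    using x \<delta>(1) unfolding seq_converges_to_def by blast
  obtain K where K: "\<bar>y n - b\<bar> < \<delta>" if "n \<ge> K" for n
    using y \<delta>(1) unfolding seq_converges_to_def by blast
  have "\<bar>(x n - y n) - (a - b)\<bar> < \<epsilon>" if n: "n \<ge> max N K" for n
  proof -
    have "\<bar>(x n - y n) - (a - b)\<bar> = \<bar>(x n - a) - (y n - b)\<bar>"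
      by (simp add: algebra_simps)
    also have "\<dots> \<le> \<bar>x n - a\<bar> + \<bar>y n - b\<bar>"
      by (rule abs_triangle_ineq4)
    also have "\<dots> < \<delta> + \<delta>"
      using N[of n] K[of n] n by (intro add_strict_mono) auto
    finally show ?thesis
      using \<delta>(2) by simp
  qed
  then show "\<exists>N. \<forall>n\<ge>N. \<bar>(x n - y n) - (a - b)\<bar> < \<epsilon>"
    by blast
qed

text \<open>The difference of the sequence with itself is constantly \<open>0\<close>, and a constant within every
  positive distance of \<open>a - b\<close> equals \<open>a - b\<close>.\<close>

lemma seq_converges_unique:
  fixes a b :: "'a::linordered_idom"
  assumes "dense_ring TYPE('a)"
    and "seq_converges_to x a" and "seq_converges_to x b"
  shows "a = b"
proof (rule ccontr)
  assume "a \<noteq> b"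
  then have "\<bar>a - b\<bar> > 0"
    by simp
  moreover have "seq_converges_to (\<lambda>n. 0) (a - b)"
    using seq_converges_diff[OF assms] by simp
  ultimately obtain N :: nat where "\<forall>n\<ge>N. \<bar>0 - (a - b)\<bar> < \<bar>a - b\<bar>"
    unfolding seq_converges_to_def by blast
  then show False
    by auto
qed

text \<open>To get within \<open>\<epsilon>\<close> after multiplication by \<open>c\<close>, shrinkability supplies an accuracy \<open>\<delta>\<close> with
  \<open>\<bar>c\<bar> * \<delta> < \<epsilon>\<close>, in the role of \<open>\<epsilon> / \<bar>c\<bar>\<close>.\<close>

lemma seq_converges_mult_left:
  fixes a c :: "'a::linordered_idom"
  assumes shrink: "shrinkable_ring TYPE('a)" and x: "seq_converges_to x a"
  shows "seq_converges_to (\<lambda>n. c * x n) (c * a)"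
proof (cases "c = 0")
  case True
  then show ?thesis
    by (simp add: seq_converges_const)
next
  case False
  show ?thesis
    unfolding seq_converges_to_def
  proof (intro allI impI)
    fix \<epsilon> :: 'a
    assume "\<epsilon> > 0"
    moreover have "\<bar>c\<bar> > 0"
      using False by simp
    ultimately obtain \<delta> where \<delta>: "\<delta> > 0" "\<bar>c\<bar> * \<delta> < \<epsilon>"
      using shrink unfolding shrinkable_ring_def by blast
    obtain N where N: "\<bar>x n - a\<bar> < \<delta>" if "n \<ge> N" for n
      using x \<delta>(1) unfolding seq_converges_to_def by blast
    have "\<bar>c * x n - c * a\<bar> < \<epsilon>" if "n \<ge> N" for n
    proof -
      have "\<bar>c * x n - c * a\<bar> = \<bar>c\<bar> * \<bar>x n - a\<bar>"
        by (simp add: abs_mult flip: right_diff_distrib)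
      also have "\<dots> \<le> \<bar>c\<bar> * \<delta>"
        using N[OF that] by (intro mult_left_mono) auto
      finally show ?thesis
        using \<delta>(2) by simp
    qed
    then show "\<exists>N. \<forall>n\<ge>N. \<bar>c * x n - c * a\<bar> < \<epsilon>"
      by blast
  qed
qed

lemma seq_converges_Suc_iff:
  "seq_converges_to (\<lambda>n. x (Suc n)) a \<longleftrightarrow> seq_converges_to x a"
proof
  assume "seq_converges_to x a"
  then show "seq_converges_to (\<lambda>n. x (Suc n)) a"
    unfolding seq_converges_to_def by (meson le_SucI)
next
  assume shifted: "seq_converges_to (\<lambda>n. x (Suc n)) a"
  show "seq_converges_to x a"
    unfolding seq_converges_to_def
  proof (intro allI impI)
    fix \<epsilon> :: 'a
    assume "\<epsilon> > 0"
    then obtain N where "\<forall>n\<ge>N. \<bar>x (Suc n) - a\<bar> < \<epsilon>"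
      using shifted unfolding seq_converges_to_def by blast
    then have "\<forall>n\<ge>Suc N. \<bar>x n - a\<bar> < \<epsilon>"
      by (metis Suc_le_D Suc_le_mono)
    then show "\<exists>N. \<forall>n\<ge>N. \<bar>x n - a\<bar> < \<epsilon>"
      by blast
  qed
qed

lemma seq_converges_successive_diff:
  fixes a :: "'a::linordered_idom"
  assumes "dense_ring TYPE('a)" and "seq_converges_to x a"
  shows "seq_converges_to (\<lambda>n. x (Suc n) - x n) 0"
  using seq_converges_diff[OF assms(1), of "\<lambda>n. x (Suc n)" a x a] assms(2)
  by (simp add: seq_converges_Suc_iff)

lemma power_limit_zero:
  fixes r :: "'a::linordered_idom"
  assumes dense: "dense_ring TYPE('a)" and shrink: "shrinkable_ring TYPE('a)"
    and "r \<noteq> 1" and lim: "seq_converges_to (\<lambda>n. r ^ n) a"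
  shows "a = 0"
proof -
  have "r ^ Suc n - r ^ n = (r - 1) * r ^ n" for n
    by (simp add: algebra_simps)
  then have "seq_converges_to (\<lambda>n. (r - 1) * r ^ n) 0"
    using seq_converges_successive_diff[OF dense lim] by simp
  moreover have "seq_converges_to (\<lambda>n. (r - 1) * r ^ n) ((r - 1) * a)"
    by (rule seq_converges_mult_left[OF shrink lim])
  ultimately have "0 = (r - 1) * a"
    by (rule seq_converges_unique[OF dense])
  then show "a = 0"
    using \<open>r \<noteq> 1\<close> by simp
qed

text \<open>This is the limit of the right-hand side of the identity for the partial sums, needed in both
  directions of the criterion.\<close>

lemma one_minus_power_Suc_converges:
  fixes r :: "'a::linordered_idom"
  assumes "dense_ring TYPE('a)" and "seq_converges_to (\<lambda>n. r ^ n) 0"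
  shows "seq_converges_to (\<lambda>n. 1 - r ^ Suc n) 1"
  using seq_converges_diff[OF assms(1) seq_converges_const[of 1], of "\<lambda>n. r ^ Suc n" 0]
    assms(2) seq_converges_Suc_iff[of "\<lambda>n. r ^ n" 0]
  by simp

lemma geometric_series_limitD:
  fixes r :: "'a::linordered_idom"
  assumes dense: "dense_ring TYPE('a)" and shrink: "shrinkable_ring TYPE('a)"
    and lim: "seq_converges_to (\<lambda>n. \<Sum>k\<le>n. r ^ k) s"
  shows "seq_converges_to (\<lambda>n. r ^ n) 0" and "(1 - r) * s = 1"
proof -
  have "seq_converges_to (\<lambda>n. r ^ Suc n) 0"
    using seq_converges_successive_diff[OF dense lim] by simp
  then show null: "seq_converges_to (\<lambda>n. r ^ n) 0"
    by (simp only: seq_converges_Suc_iff[of "\<lambda>n. r ^ n"])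
  have "seq_converges_to (\<lambda>n. 1 - r ^ Suc n) ((1 - r) * s)"
    using seq_converges_mult_left[OF shrink lim, of "1 - r"]
    by (simp only: sum_gp_basic)
  then show "(1 - r) * s = 1"
    using one_minus_power_Suc_converges[OF dense null]
    by (rule seq_converges_unique[OF dense])
qed

lemma geometric_series_converges:
  fixes r u :: "'a::linordered_idom"
  assumes dense: "dense_ring TYPE('a)" and shrink: "shrinkable_ring TYPE('a)"
    and null: "seq_converges_to (\<lambda>n. r ^ n) 0" and inverse: "(1 - r) * u = 1"
  shows "seq_converges_to (\<lambda>n. \<Sum>k\<le>n. r ^ k) u"
proof -
  have "u * (1 - r ^ Suc n) = (\<Sum>k\<le>n. r ^ k)" for n
  proof -
    have "u * (1 - r ^ Suc n) = ((1 - r) * u) * (\<Sum>k\<le>n. r ^ k)"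
      by (simp only: sum_gp_basic[symmetric] ac_simps)
    then show ?thesis
      by (simp only: inverse mult_1_left)
  qed
  then show ?thesis
    using seq_converges_mult_left[OF shrink one_minus_power_Suc_converges[OF dense null], of u]
    by (simp only: mult_1_right)
qed

theorem theorem4p1:
  fixes r :: "'a::linordered_idom"
  assumes "dense_ring TYPE('a)"
    and "shrinkable_ring TYPE('a)"
    and "r \<noteq> 1"
  shows "(seq_convergent (\<lambda>n. r ^ n) \<longrightarrow> seq_converges_to (\<lambda>n. r ^ n) 0) \<and>
         (series_convergent (\<lambda>n. r ^ n) \<longleftrightarrow>
            seq_converges_to (\<lambda>n. r ^ n) 0 \<and> (1 - r) dvd 1)"
proof (intro conjI impI iffI)
  assume "seq_convergent (\<lambda>n. r ^ n)"
  then show "seq_converges_to (\<lambda>n. r ^ n) 0"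
    using power_limit_zero[OF assms] unfolding seq_convergent_def by blast
next
  assume "series_convergent (\<lambda>n. r ^ n)"
  then obtain s where "seq_converges_to (\<lambda>n. \<Sum>k\<le>n. r ^ k) s"
    unfolding series_convergent_def seq_convergent_def by blast
  note limitD = geometric_series_limitD[OF assms(1,2) this]
  show "seq_converges_to (\<lambda>n. r ^ n) 0"
    by (rule limitD(1))
  show "(1 - r) dvd 1"
    using limitD(2) by (metis dvdI)
next
  assume null: "seq_converges_to (\<lambda>n. r ^ n) 0 \<and> (1 - r) dvd 1"
  then obtain u where "(1 - r) * u = 1"
    by (metis dvdE)
  then show "series_convergent (\<lambda>n. r ^ n)"
    using geometric_series_converges[OF assms(1,2)] null
    unfolding series_convergent_def seq_convergent_def by blast
qed

end
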